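(* Let $T\in A\otimes B\otimes C=\mathbb C^m\otimes\mathbb C^m\otimes\mathbb C^m$ be concise, 111-sharp and of minimal border rank. Then the $S$-modules $\underline A$, $\underline B$, $\underline C$ lie in the principal component of the Quot scheme.
   Context: $A,B,C$ are complex vector spaces of dimension $m$; for $T\in A\otimes B\otimes C$ let $T(A^* )\subseteq B\otimes C$, $T(B^* )\subseteq A\otimes C$, $T(C^* )\subseteq A\otimes B$ be the images of the induced maps; $T$ is concise if these maps are injective. $T$ is 111-sharp if $(T(A^* )\otimes A)\cap(T(B^* )\otimes B)\cap(T(C^* )\otimes C)\subseteq A\otimes B\otimes C$ (factors in the correct positions) has dimension exactly $m$. The border rank of $T$ is the smallest $r$ such that $T$ is a limit of sums of $r$ rank one tensors; a concise tensor has minimal border rank if its border rank is $m$. The 111-algebra $\mathcal A_{111}^T\subseteq\mathrm{End}(A)\times\mathrm{End}(B)\times\mathrm{End}(C)$ is the set of triples $(X,Y,Z)$ such that $(X\otimes\mathrm{Id}_B\otimes\mathrm{Id}_C)(T)=(\mathrm{Id}_A\otimes Y\otimes\mathrm{Id}_C)(T)=(\mathrm{Id}_A\otimes\mathrm{Id}_B\otimes Z)(T)$; for concise $T$ it is a commutative unital algebra, of dimension $m$ if $T$ is 111-sharp. Through the three projections, $A,B,C$ become $\mathcal A_{111}^T$-modules. Let $S=\mathbb C[y_1,\dots,y_{m-1}]$ and fix the surjection $S\to\mathcal A_{111}^T$ sending $1$ to $(\mathrm{Id},\mathrm{Id},\mathrm{Id})$ and $y_1,\dots,y_{m-1}$ to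 the remaining elements of a basis of $\mathcal A_{111}^T$ whose first element is $(\mathrm{Id},\mathrm{Id},\mathrm{Id})$. Via this surjection $A,B,C$ become $S$-modules $\underline A,\underline B,\underline C$ (the conclusion does not depend on the choice). The Quot scheme parametrizes quotient $S$-modules of $S^{\oplus r}$ of $\mathbb C$-dimension $m$ ($r$ fixed large enough); its principal component is the closure of the locus of semisimple modules, i.e. modules of the form $N_1\oplus\cdots\oplus N_m$ with $\dim N_h=1$ for all $h$. An $m$-dimensional $S$-module lies in the principal component if and only if it is a limit of semisimple modules, equivalently the commuting tuple of $m\times m$ matrices giving the actions of $y_1,\dots,y_{m-1}$ is a limit of simultaneously diagonalizable tuples. *)

theory Defs
  imports "HOL-Analysis.Analysis" "HOL-Library.Poly_Mapping"
begin

section \<open>Tensors in \<open>A \<otimes> B \<otimes> C\<close> with \<open>A = B = C = \<complex>\<^sup>m\<close>\<close>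

text \<open>
  \<open>m\<close> is \<open>CARD('m)\<close>. A tensor \<open>T\<close> has coordinates \<open>T $ i $ j $ k\<close>, where \<open>i\<close>, \<open>j\<close>, \<open>k\<close> index
  \<open>A\<close>, \<open>B\<close>, \<open>C\<close>. An element of \<open>B \<otimes> C\<close>, \<open>A \<otimes> C\<close> or \<open>A \<otimes> B\<close> is a matrix whose indices are in
  that order. Dual spaces are identified with \<open>\<complex>\<^sup>m\<close> through the dual basis, and endomorphisms of
  \<open>\<complex>\<^sup>m\<close> are matrices.

  The types below are real vector spaces in the library, so the complex scalar
  multiplications are introduced by hand.
\<close>

type_synonym 'm mat = "complex^'m^'m"
type_synonym 'm tensor = "complex^'m^'m^'m"
type_synonym 'm triple = "'m mat \<times> 'm mat \<times> 'm mat"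

definition mat_scale :: "complex \<Rightarrow> 'm::finite mat \<Rightarrow> 'm mat"
  where "mat_scale c M = (\<chi> i j. c * M $ i $ j)"

definition tensor_scale :: "complex \<Rightarrow> 'm::finite tensor \<Rightarrow> 'm tensor"
  where "tensor_scale c T = (\<chi> i j k. c * T $ i $ j $ k)"

definition triple_scale :: "complex \<Rightarrow> 'm::finite triple \<Rightarrow> 'm triple"
  where "triple_scale c = (\<lambda>(X, Y, Z). (mat_scale c X, mat_scale c Y, mat_scale c Z))"

interpretation cmat: vector_space mat_scale
  by unfold_locales (simp_all add: mat_scale_def vec_eq_iff distrib_left distrib_right)

interpretation ctensor: vector_space tensor_scale
  by unfold_locales (simp_all add: tensor_scale_def vec_eq_iff distrib_left distrib_right)

interpretation ctriple: vector_space triple_scale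
  by unfold_locales
    (auto simp: triple_scale_def cmat.scale_right_distrib cmat.scale_left_distrib)

definition tensor_prod ::
  "complex^'m::finite \<Rightarrow> complex^'m \<Rightarrow> complex^'m \<Rightarrow> 'm tensor"
  where "tensor_prod a b c = (\<chi> i j k. a $ i * b $ j * c $ k)"

definition rank_one :: "'m::finite tensor \<Rightarrow> bool"
  where "rank_one T \<longleftrightarrow>
    (\<exists>a b c. a \<noteq> 0 \<and> b \<noteq> 0 \<and> c \<noteq> 0 \<and> T = tensor_prod a b c)"

definition sums_of_rank_one :: "nat \<Rightarrow> 'm::finite tensor set"
  where "sums_of_rank_one r = {\<Sum>s<r. t s | t. \<forall>s<r. rank_one (t s)}"

definition border_rank :: "'m::finite tensor \<Rightarrow> nat"
  where "border_rank T = (LEAST r. T \<in> closure (sums_of_rank_one r))"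

definition contract_A :: "'m::finite tensor \<Rightarrow> complex^'m \<Rightarrow> 'm mat"
  where "contract_A T \<alpha> = (\<chi> j k. \<Sum>i\<in>UNIV. \<alpha> $ i * T $ i $ j $ k)"

definition contract_B :: "'m::finite tensor \<Rightarrow> complex^'m \<Rightarrow> 'm mat"
  where "contract_B T \<beta> = (\<chi> i k. \<Sum>j\<in>UNIV. \<beta> $ j * T $ i $ j $ k)"

definition contract_C :: "'m::finite tensor \<Rightarrow> complex^'m \<Rightarrow> 'm mat"
  where "contract_C T \<gamma> = (\<chi> i j. \<Sum>k\<in>UNIV. \<gamma> $ k * T $ i $ j $ k)"

definition concise :: "'m::finite tensor \<Rightarrow> bool"
  where "concise T \<longleftrightarrow> inj (contract_A T) \<and> inj (contract_B T) \<and> inj (contract_C T)"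

definition minimal_border_rank :: "'m::finite tensor \<Rightarrow> bool"
  where "minimal_border_rank T \<longleftrightarrow> concise T \<and> border_rank T = CARD('m)"

text \<open>
  For a subspace \<open>W\<close> of \<open>B \<otimes> C\<close>, the subspace \<open>W \<otimes> A\<close> of \<open>A \<otimes> B \<otimes> C\<close>; likewise for the other
  two factors.
\<close>

definition tensor_with_A :: "'m::finite mat set \<Rightarrow> 'm tensor set"
  where "tensor_with_A W = ctensor.span {\<chi> i j k. a $ i * w $ j $ k | a w. w \<in> W}"

definition tensor_with_B :: "'m::finite mat set \<Rightarrow> 'm tensor set"
  where "tensor_with_B W = ctensor.span {\<chi> i j k. b $ j * w $ i $ k | b w. w \<in> W}"

definition tensor_with_C :: "'m::finite mat set \<Rightarrow> 'm tensor set"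
  where "tensor_with_C W = ctensor.span {\<chi> i j k. c $ k * w $ i $ j | c w. w \<in> W}"

definition sharp_111 :: "'m::finite tensor \<Rightarrow> bool"
  where "sharp_111 T \<longleftrightarrow>
    ctensor.dim (tensor_with_A (range (contract_A T)) \<inter>
                 tensor_with_B (range (contract_B T)) \<inter>
                 tensor_with_C (range (contract_C T))) = CARD('m)"


section \<open>The 111-algebra\<close>

definition act_A :: "'m::finite mat \<Rightarrow> 'm tensor \<Rightarrow> 'm tensor"
  where "act_A X T = (\<chi> i j k. \<Sum>l\<in>UNIV. X $ i $ l * T $ l $ j $ k)"

definition act_B :: "'m::finite mat \<Rightarrow> 'm tensor \<Rightarrow> 'm tensor"
  where "act_B Y T = (\<chi> i j k. \<Sum>l\<in>UNIV. Y $ j $ l * T $ i $ l $ k)"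

definition act_C :: "'m::finite mat \<Rightarrow> 'm tensor \<Rightarrow> 'm tensor"
  where "act_C Z T = (\<chi> i j k. \<Sum>l\<in>UNIV. Z $ k $ l * T $ i $ j $ l)"

definition algebra_111 :: "'m::finite tensor \<Rightarrow> 'm triple set"
  where "algebra_111 T = {(X, Y, Z). act_A X T = act_B Y T \<and> act_B Y T = act_C Z T}"

definition id_triple :: "'m::finite triple"
  where "id_triple = (mat 1, mat 1, mat 1)"

text \<open>\<open>e 0, \<dots>, e (m - 1)\<close> is a basis of the 111-algebra whose first element is the unit.\<close>

definition unital_basis_111 :: "'m::finite tensor \<Rightarrow> (nat \<Rightarrow> 'm triple) \<Rightarrow> bool"
  where "unital_basis_111 T e \<longleftrightarrow>
    e 0 = id_triple \<and> inj_on e {..<CARD('m)} \<and>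
    ctriple.independent (e ` {..<CARD('m)}) \<and>
    ctriple.span (e ` {..<CARD('m)}) = algebra_111 T"


section \<open>The polynomial ring \<open>S = \<complex>[y\<^sub>1, \<dots>, y\<^bsub>m-1\<^esub>]\<close>\<close>

lemma keys_mult_within:
  fixes p q :: "('a \<Rightarrow>\<^sub>0 nat) \<Rightarrow>\<^sub>0 'b::semiring_0"
  assumes p: "\<And>u. u \<in> Poly_Mapping.keys p \<Longrightarrow> Poly_Mapping.keys u \<subseteq> V"
    and q: "\<And>u. u \<in> Poly_Mapping.keys q \<Longrightarrow> Poly_Mapping.keys u \<subseteq> V"
    and u: "u \<in> Poly_Mapping.keys (p * q)"
  shows "Poly_Mapping.keys u \<subseteq> V"
proof -
  obtain v w where "u = v + w" "v \<in> Poly_Mapping.keys p" "w \<in> Poly_Mapping.keys q"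
    using u keys_mult[of p q] by blast
  then show ?thesis
    using p q keys_add[of v w] by blast
qed

text \<open>
  The ring is carved out of the polynomials in variables indexed by \<^typ>\<open>nat\<close>, rather than
  being indexed by a type of variables, so that \<open>m = 1\<close> (no variables) is not excluded.
  The type argument records only \<open>m = CARD('m)\<close>.
\<close>

typedef 'm poly_ring =
  "{p :: (nat \<Rightarrow>\<^sub>0 nat) \<Rightarrow>\<^sub>0 complex. \<forall>u\<in>Poly_Mapping.keys p. Poly_Mapping.keys u \<subseteq> {1..<CARD('m)}}"
  by (rule exI[of _ 0]) simp

setup_lifting type_definition_poly_ring

instantiation poly_ring :: (type) comm_ring_1
begin

lift_definition zero_poly_ring :: "'a poly_ring" is 0
  by simp

lift_definition one_poly_ring :: "'a poly_ring" is 1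
  by simp

lift_definition plus_poly_ring :: "'a poly_ring \<Rightarrow> 'a poly_ring \<Rightarrow> 'a poly_ring" is "(+)"
  by (meson keys_add Un_iff subsetD)

lift_definition minus_poly_ring :: "'a poly_ring \<Rightarrow> 'a poly_ring \<Rightarrow> 'a poly_ring" is "(-)"
  by (meson keys_diff Un_iff subsetD)

lift_definition uminus_poly_ring :: "'a poly_ring \<Rightarrow> 'a poly_ring" is uminus
  by simp

lift_definition times_poly_ring :: "'a poly_ring \<Rightarrow> 'a poly_ring \<Rightarrow> 'a poly_ring" is "(*)"
  by (rule keys_mult_within)

instance
proof
  fix a b c :: "'a poly_ring"
  show "a * b * c = a * (b * c)" by transfer (rule mult.assoc)
  show "a * b = b * a" by transfer (rule mult.commute)
  show "1 * a = a" by transfer (rule mult_1_left)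
  show "a + b + c = a + (b + c)" by transfer (rule add.assoc)
  show "a + b = b + a" by transfer (rule add.commute)
  show "0 + a = a" by transfer (rule add_0_left)
  show "- a + a = 0" by transfer (rule left_minus)
  show "a - b = a + - b" by transfer (rule diff_conv_add_uminus)
  show "(a + b) * c = a * c + b * c" by transfer (rule distrib_right)
  show "(0 :: 'a poly_ring) \<noteq> 1" by transfer (rule zero_neq_one)
qed

end

lift_definition poly_const :: "complex \<Rightarrow> 'm poly_ring" is "Poly_Mapping.single 0"
  by (simp split: if_splits)

text \<open>
  Evaluation at \<open>y\<^sub>i \<mapsto> X i\<close> for \<open>1 \<le> i < m\<close>. The matrices \<open>X i\<close> will commute, so the order of the
  factors of a monomial is immaterial. The powers are written as iterated left multiplications,
  as \<open>^\<close> on matrices would be entrywise.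
\<close>

definition mat_eval :: "(nat \<Rightarrow> 'm::finite mat) \<Rightarrow> 'm poly_ring \<Rightarrow> 'm mat"
  where "mat_eval X p =
    (\<Sum>u\<in>Poly_Mapping.keys (Rep_poly_ring p).
      mat_scale (Poly_Mapping.lookup (Rep_poly_ring p) u)
        (foldr (\<lambda>i. ((**) (X i)) ^^ Poly_Mapping.lookup u i) [1..<CARD('m)] (mat 1)))"

definition poly_to_111 :: "(nat \<Rightarrow> 'm::finite triple) \<Rightarrow> 'm poly_ring \<Rightarrow> 'm triple"
  where "poly_to_111 e p =
    (mat_eval (\<lambda>i. fst (e i)) p,
     mat_eval (\<lambda>i. fst (snd (e i))) p,
     mat_eval (\<lambda>i. snd (snd (e i))) p)"

text \<open>The scalar multiplications of the \<open>S\<close>-modules with underlying spaces \<open>A\<close>, \<open>B\<close>, \<open>C\<close>.\<close>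

definition module_A ::
  "(nat \<Rightarrow> 'm::finite triple) \<Rightarrow> 'm poly_ring \<Rightarrow> complex^'m \<Rightarrow> complex^'m"
  where "module_A e p a = fst (poly_to_111 e p) *v a"

definition module_B ::
  "(nat \<Rightarrow> 'm::finite triple) \<Rightarrow> 'm poly_ring \<Rightarrow> complex^'m \<Rightarrow> complex^'m"
  where "module_B e p b = fst (snd (poly_to_111 e p)) *v b"

definition module_C ::
  "(nat \<Rightarrow> 'm::finite triple) \<Rightarrow> 'm poly_ring \<Rightarrow> complex^'m \<Rightarrow> complex^'m"
  where "module_C e p c = snd (snd (poly_to_111 e p)) *v c"


section \<open>The Quot scheme and its principal component\<close>

type_synonym ('m, 'r) free_mod = "'m poly_ring ^ 'r"

interpretation free_mod: module "(*s) :: 'm poly_ring \<Rightarrow> ('m, 'r::finite) free_mod \<Rightarrow> _"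
  by unfold_locales (simp_all add: vec_eq_iff distrib_left distrib_right mult.assoc)

text \<open>
  A closed point of the Quot scheme of \<open>S\<^sup>r\<close>, with \<open>r = CARD('r)\<close>, is represented by the kernel
  \<open>K\<close> of the quotient map \<open>S\<^sup>r \<rightarrow> S\<^sup>r/K\<close>.
  The first definition says that the classes of the \<open>m\<close> elements \<open>b h\<close> form a
  \<open>\<complex>\<close>-basis of \<open>S\<^sup>r/K\<close>, the second gives the coordinates of the class of \<open>f\<close> in this basis.
\<close>

definition quotient_basis ::
  "('m::finite, 'r::finite) free_mod set \<Rightarrow> ('m \<Rightarrow> ('m, 'r) free_mod) \<Rightarrow> bool"
  where "quotient_basis K b \<longleftrightarrow>
    (\<forall>f. \<exists>!c::complex^'m. f - (\<Sum>h\<in>UNIV. poly_const (c $ h) *s b h) \<in> K)"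

definition quotient_coords ::
  "('m::finite \<Rightarrow> ('m, 'r::finite) free_mod) \<Rightarrow> ('m, 'r) free_mod set \<Rightarrow>
    ('m, 'r) free_mod \<Rightarrow> complex^'m"
  where "quotient_coords b K f =
    (THE c. f - (\<Sum>h\<in>UNIV. poly_const (c $ h) *s b h) \<in> K)"

definition quot_points :: "('m::finite, 'r::finite) free_mod set set"
  where "quot_points = {K. free_mod.subspace K \<and> (\<exists>b. quotient_basis K b)}"

text \<open>
  For \<open>b :: 'm \<Rightarrow> S\<^sup>r\<close> the points \<open>K\<close> at which \<open>b\<close> induces a basis of \<open>S\<^sup>r/K\<close> form an affine
  open chart of the Quot scheme. Its coordinate ring is generated by the coordinates, in the
  basis \<open>b\<close>, of the classes of the elements of \<open>S\<^sup>r\<close>. These charts cover the Quot scheme, so that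
  their principal open subsets form a base of the Zariski topology on the set of closed points.
\<close>

inductive_set chart_functions ::
  "('m::finite \<Rightarrow> ('m, 'r::finite) free_mod) \<Rightarrow> (('m, 'r) free_mod set \<Rightarrow> complex) set"
  for b :: "'m \<Rightarrow> ('m, 'r) free_mod"
where
  const: "(\<lambda>K. c) \<in> chart_functions b"
| coord: "(\<lambda>K. quotient_coords b K f $ h) \<in> chart_functions b"
| add: "g \<in> chart_functions b \<Longrightarrow> g' \<in> chart_functions b \<Longrightarrow>
    (\<lambda>K. g K + g' K) \<in> chart_functions b"
| mult: "g \<in> chart_functions b \<Longrightarrow> g' \<in> chart_functions b \<Longrightarrow>
    (\<lambda>K. g K * g' K) \<in> chart_functions b"

definition quot_zariski :: "('m::finite, 'r::finite) free_mod set topology"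
  where "quot_zariski = topology_generated_by
    {{K \<in> quot_points. quotient_basis K b \<and> g K \<noteq> 0} | b g. g \<in> chart_functions b}"

text \<open>
  \<open>S\<^sup>r/K = N\<^sub>1 \<oplus> \<dots> \<oplus> N\<^sub>m\<close> with one-dimensional submodules \<open>N\<^sub>h\<close>: the line \<open>N\<^sub>h\<close> is spanned by the
  class of \<open>b h\<close>, and it is a submodule because every \<open>p \<in> S\<close> acts on that class by a scalar.
\<close>

definition semisimple_quotient :: "('m::finite, 'r::finite) free_mod set \<Rightarrow> bool"
  where "semisimple_quotient K \<longleftrightarrow>
    (\<exists>b. quotient_basis K b \<and>
      (\<forall>h p. \<exists>\<mu>. p *s b h - poly_const \<mu> *s b h \<in> K))"

definition principal_component :: "('m::finite, 'r::finite) free_mod set set"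
  where "principal_component =
    quot_zariski closure_of {K \<in> quot_points. semisimple_quotient K}"

text \<open>
  The \<open>S\<close>-module with scalar multiplication \<open>act\<close> lies in the principal component of the Quot
  scheme of \<open>S\<^sup>r\<close>. It can be presented as a quotient of \<open>S\<^sup>r\<close>, and the point given by any such
  presentation is in the principal component.
\<close>

definition lies_in_principal_component ::
  "'r::finite itself \<Rightarrow> ('m::finite poly_ring \<Rightarrow> complex^'m \<Rightarrow> complex^'m) \<Rightarrow> bool"
  where "lies_in_principal_component _ act \<longleftrightarrow>
    (\<exists>\<phi> :: ('m, 'r) free_mod \<Rightarrow> complex^'m. module_hom (*s) act \<phi> \<and> surj \<phi>) \<and>
    (\<forall>\<phi> :: ('m, 'r) free_mod \<Rightarrow> complex^'m. module_hom (*s) act \<phi> \<and> surj \<phi> \<longrightarrow>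
      {f. \<phi> f = 0} \<in> principal_component)"

end

theory Submission
  imports Defs "HOL-Computational_Algebra.Polynomial"
begin

text \<open>
  Suppose first that \<open>T = \<Sum>\<^sub>s a\<^sub>s \<otimes> b\<^sub>s \<otimes> c\<^sub>s\<close>, where the \<open>a\<^sub>s\<close>, the \<open>b\<^sub>s\<close> and the \<open>c\<^sub>s\<close> are bases.
  Multiplying the summand \<open>s\<close> by a scalar \<open>d\<^sub>s\<close> can be done in any of the three factors, so the
  triples of operators that are diagonal in these bases, with the same eigenvalues \<open>d\<^sub>s\<close>, form
  an \<open>m\<close>-dimensional subspace of the 111-algebra, and the three modules which they define are
  semisimple.

  A tensor of minimal border rank is a limit of tensors \<open>T\<^sub>n\<close> of this kind: it is a limit of sums of
  \<open>m\<close> rank one tensors, and since invertible matrices are dense the factors can be perturbed to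
  bases. The condition defining the 111-algebra is closed in the pair of triple and tensor.
  Orthonormal bases of the diagonal subspaces for \<open>T\<^sub>n\<close> therefore subconverge to an orthonormal
  family in the 111-algebra of \<open>T\<close>. This algebra has dimension \<open>m\<close> too, being spanned by
  \<open>e 0, \<dots>, e (m - 1)\<close>, so the limit family spans it, and every element of the 111-algebra of \<open>T\<close> is a limit of elements of the diagonal subspaces. This is
  \<open>algebra_111_limit_of_diagonal_algebras\<close>. In particular the tuples of matrices by which
  the \<open>y\<^sub>i\<close> act on \<open>A\<close>, \<open>B\<close> and \<open>C\<close> are limits of simultaneously diagonalizable tuples.

  It remains to pass from matrices to the Quot scheme, in \<open>kernel_in_principal_component\<close>. Given a
  presentation \<open>\<phi>\<close> of the limit module, send the same generators to the same vectors but let the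
  \<open>y\<^sub>i\<close> act through the approximating tuples. The resulting maps converge to \<open>\<phi>\<close>
  pointwise. By Cramer's rule the coordinate functions of every chart around \<open>ker \<phi>\<close> converge
  along their kernels, which are eventually semisimple points. Hence these points enter every
  Zariski neighbourhood of \<open>ker \<phi>\<close>.
\<close>

section \<open>Matrices and limits of subspaces\<close>

lemma matrix_vector_axis:
  fixes A :: "complex^'n^'m"
  shows "A *v axis k 1 = column k A"
  by (simp add: matrix_vector_mult_def column_def axis_def vec_eq_iff if_distrib cong: if_cong)

lemma matrix_matrix_add_rdistrib:
  fixes A B :: "complex^'n^'m"
  shows "(A + B) ** C = A ** C + B ** C"
  by (simp add: matrix_matrix_mult_def vec_eq_iff distrib_right sum.distrib)

lemma tendsto_det:
  fixes M :: "'a \<Rightarrow> complex^'n^'n"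
  assumes "(M \<longlongrightarrow> L) F"
  shows "((\<lambda>x. det (M x)) \<longlongrightarrow> det L) F"
  unfolding det_def by (intro tendsto_intros assms)

lemma tendsto_matrix_mult:
  fixes M :: "'a \<Rightarrow> complex^'n^'m" and N :: "'a \<Rightarrow> complex^'k^'n"
  assumes "(M \<longlongrightarrow> L) F" "(N \<longlongrightarrow> K) F"
  shows "((\<lambda>x. M x ** N x) \<longlongrightarrow> L ** K) F"
  unfolding matrix_matrix_mult_def by (intro tendsto_intros assms)

lemma tendsto_matrix_vector_mult:
  fixes M :: "'a \<Rightarrow> complex^'n^'m"
  assumes "(M \<longlongrightarrow> L) F" "(v \<longlongrightarrow> w) F"
  shows "((\<lambda>x. M x *v v x) \<longlongrightarrow> L *v w) F"
  unfolding matrix_vector_mult_def by (intro tendsto_intros assms)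

lemma tendsto_mat_scale:
  assumes "(M \<longlongrightarrow> L) F"
  shows "((\<lambda>x. mat_scale c (M x)) \<longlongrightarrow> mat_scale c L) F"
  unfolding mat_scale_def by (intro tendsto_intros assms)

text \<open>
  By Cramer's rule the solution of a regular linear system depends continuously on
  the matrix and the right-hand side.
\<close>

lemma tendsto_linear_solution:
  fixes M :: "'a \<Rightarrow> complex^'n^'n"
  assumes "(M \<longlongrightarrow> L) F" and "(y \<longlongrightarrow> z) F" and "det L \<noteq> 0"
    and "L *v c = z" and "\<forall>\<^sub>F x in F. M x *v d x = y x"
  shows "(d \<longlongrightarrow> c) F"
proof -
  define sol where "sol M y = (\<chi> k. det (\<chi> i j. if j = k then y $ i else M $ i $ j) / det M)"
    for M :: "complex^'n^'n" and y
  have lim: "((\<lambda>x. sol (M x) (y x)) \<longlongrightarrow> sol L z) F"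
    unfolding sol_def
  proof (intro tendsto_vec_lambda tendsto_divide tendsto_det assms)
    fix k i j
    show "((\<lambda>x. if j = k then y x $ i else M x $ i $ j) \<longlongrightarrow> (if j = k then z $ i else L $ i $ j)) F"
      by (cases "j = k") (auto intro!: tendsto_intros assms)
  qed
  have "\<forall>\<^sub>F x in F. det (M x) \<noteq> 0"
    using tendsto_det[OF assms(1)] assms(3) tendsto_imp_eventually_ne by blast
  then have "\<forall>\<^sub>F x in F. sol (M x) (y x) = d x"
    using assms(5) by eventually_elim (simp add: sol_def cramer)
  moreover have "sol L z = c"
    using assms(3,4) by (simp add: sol_def cramer)
  ultimately show ?thesis
    using lim tendsto_cong by fastforce
qed

text \<open>
  On the line through \<open>A\<close> and the identity matrix the determinant is a polynomial with value \<open>1\<close>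
  at the identity, so it has finitely many zeros and \<open>A\<close> is a limit of invertible matrices on the
  line.
\<close>

lemma closure_invertible_matrices:
  "closure {A :: complex^'n^'n. det A \<noteq> 0} = UNIV"
proof -
  have "A \<in> closure {A. det A \<noteq> 0}" for A :: "complex^'n^'n"
  proof -
    \<comment> \<open>A matrix of polynomials in the parameter of the line, equal to \<open>A\<close> at \<open>0\<close> and to the identity at \<open>1\<close>.\<close>
    define B where "B = (\<chi> i j. [: A $ i $ j, mat 1 $ i $ j - A $ i $ j :])"
    define seg where "seg x = (\<chi> i j. A $ i $ j + x * (mat 1 $ i $ j - A $ i $ j))" for x
    have poly_det: "poly (det B) x = det (seg x)" for x
      by (simp add: det_def poly_sum poly_prod B_def seg_def)
    have "seg 1 = mat 1"
      by (simp add: seg_def vec_eq_iff)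
    then have "det B \<noteq> 0"
      using poly_det[of 1] by auto
    then have "finite {x. poly (det B) x = 0}"
      by (rule poly_roots_finite)
    then have "\<forall>\<^sub>F x in at 0. x \<notin> {x. poly (det B) x = 0}"
      by (metis islimpt_finite islimpt_iff_eventually)
    then have ev: "\<forall>\<^sub>F x in at 0. seg x \<in> {A. det A \<noteq> 0}"
      by (simp add: poly_det)
    have "(seg \<longlongrightarrow> seg 0) (at 0)"
      unfolding seg_def by (intro tendsto_intros)
    moreover have "seg 0 = A"
      by (simp add: seg_def vec_eq_iff)
    ultimately have "(seg \<longlongrightarrow> A) (at 0)"
      by simp
    moreover have "\<forall>\<^sub>F x in at 0. seg x \<in> closure {A. det A \<noteq> 0}"
      using ev by (rule eventually_mono) (meson closure_subset subsetD)
    ultimately show ?thesis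
      by (intro Lim_in_closed_set[of "closure {A. det A \<noteq> 0}" seg "at 0"]) auto
  qed
  then show ?thesis by blast
qed

lemma convergent_subsequence_finite_family:
  fixes v :: "nat \<Rightarrow> nat \<Rightarrow> 'a::euclidean_space"
  assumes "\<And>n k. k < d \<Longrightarrow> norm (v n k) \<le> 1"
  shows "\<exists>r l. strict_mono r \<and> (\<forall>k<d. (\<lambda>n. v (r n) k) \<longlonglongrightarrow> l k)"
  using assms
proof (induction d)
  case 0
  show ?case
    by (intro exI[of _ id]) (auto simp: strict_mono_def)
next
  case (Suc d)
  then obtain r l where r: "strict_mono r" and l: "\<forall>k<d. (\<lambda>n. v (r n) k) \<longlonglongrightarrow> l k"
    by auto
  have "bounded (range (\<lambda>n. v (r n) d))"
    using Suc.prems by (auto simp: bounded_iff)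
  then obtain x s where s: "strict_mono s" and x: "((\<lambda>n. v (r n) d) \<circ> s) \<longlonglongrightarrow> x"
    using bounded_imp_convergent_subsequence by blast
  have "(\<lambda>n. v ((r \<circ> s) n) k) \<longlonglongrightarrow> (l(d := x)) k" if "k < Suc d" for k
  proof (cases "k = d")
    case True
    then show ?thesis using x by (simp add: o_def)
  next
    case False
    then have "(\<lambda>n. v (r n) k) \<longlonglongrightarrow> l k"
      using that l by simp
    from LIMSEQ_subseq_LIMSEQ[OF this s] False show ?thesis
      by (simp add: o_def)
  qed
  moreover have "strict_mono (r \<circ> s)"
    using r s by (rule strict_mono_o)
  ultimately show ?case by blast
qed

text \<open>
  Orthonormal bases of the \<open>V n\<close> converge along a subsequence. The limit is an orthonormal family
  of \<open>d\<close> vectors in \<open>W\<close>, hence a basis of \<open>W\<close> by the bound on its dimension. So expanding an element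
  of \<open>W\<close> in the limit basis and replacing the basis by those of the \<open>V n\<close> approximates it. The
  assumption \<open>lim\<close> only gives that limits of the \<open>V n\<close> lie in \<open>W\<close>; the dimension count turns this
  inclusion into the converse one.
\<close>

lemma subspaces_exhaust_limit:
  fixes V :: "nat \<Rightarrow> 'a::euclidean_space set"
  assumes V: "\<And>n. subspace (V n)" and dimV: "\<And>n. dim (V n) = d"
    and W: "subspace W" and dimW: "dim W \<le> d"
    and lim: "\<And>r v l. strict_mono r \<Longrightarrow> (\<And>n. v n \<in> V (r n)) \<Longrightarrow> v \<longlonglongrightarrow> l \<Longrightarrow> l \<in> W"
  obtains r w where "strict_mono (r :: nat \<Rightarrow> nat)" "\<And>n x. w n x \<in> V (r n)"
    "\<And>x. x \<in> W \<Longrightarrow> (\<lambda>n. w n x) \<longlonglongrightarrow> x"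
proof -
  have "\<exists>b. (\<forall>k<d. b k \<in> V n) \<and> (\<forall>j<d. \<forall>k<d. b j \<bullet> b k = (if j = k then 1 else 0))" for n
  proof -
    obtain B where B: "B \<subseteq> V n" "pairwise orthogonal B" "\<And>x. x \<in> B \<Longrightarrow> norm x = 1"
        "independent B" "card B = dim (V n)"
      using orthonormal_basis_subspace[OF V[of n]] by metis
    have "finite B" using B(4) independent_imp_finite by blast
    then obtain b where b: "bij_betw b {0..<d} B"
      using ex_bij_betw_nat_finite[of B] B(5) dimV by metis
    have mem: "b k \<in> B" if "k < d" for k
      using b that by (auto simp: bij_betw_def)
    have "b j \<bullet> b k = 0" if "j < d" "k < d" "j \<noteq> k" for j k
    proof -
      have "b j \<noteq> b k"
        using that b by (auto simp: bij_betw_def inj_on_def)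
      then show ?thesis
        using B(2) mem that by (auto simp: pairwise_def orthogonal_def)
    qed
    moreover have "b k \<bullet> b k = 1" if "k < d" for k
      using B(3)[OF mem[OF that]] by (simp add: norm_eq_1)
    ultimately show ?thesis
      using mem B(1) by (intro exI[of _ b]) auto
  qed
  then obtain b where bV: "\<And>n k. k < d \<Longrightarrow> b n k \<in> V n"
    and ortho: "\<And>n j k. j < d \<Longrightarrow> k < d \<Longrightarrow> b n j \<bullet> b n k = (if j = k then 1 else 0)"
    by metis
  have "norm (b n k) \<le> 1" if "k < d" for n k
    using ortho[OF that that, of n] by (simp add: norm_eq_1[symmetric])
  from convergent_subsequence_finite_family[of d b, OF this]
  obtain r l where r: "strict_mono r" and l: "\<forall>k<d. (\<lambda>n. b (r n) k) \<longlonglongrightarrow> l k"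
    by blast
  have lW: "l k \<in> W" if "k < d" for k
    using lim[OF r, of "\<lambda>n. b (r n) k"] bV l that by blast
  have lortho: "l j \<bullet> l k = (if j = k then 1 else 0)" if "j < d" "k < d" for j k
  proof -
    have "(\<lambda>n. b (r n) j \<bullet> b (r n) k) \<longlonglongrightarrow> l j \<bullet> l k"
      using l that by (intro tendsto_inner) auto
    then have "(\<lambda>n. if j = k then 1 else 0 :: real) \<longlonglongrightarrow> l j \<bullet> l k"
      using ortho that by simp
    then show ?thesis
      using LIMSEQ_unique tendsto_const by blast
  qed
  have inj: "inj_on l {..<d}"
    by (intro inj_onI) (metis lessThan_iff lortho zero_neq_one)
  have "independent (l ` {..<d})"
  proof (rule pairwise_orthogonal_independent)
    show "pairwise orthogonal (l ` {..<d})"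
      using lortho by (auto simp: pairwise_def orthogonal_def)
    show "0 \<notin> l ` {..<d}"
      using lortho by (metis imageE inner_zero_left lessThan_iff zero_neq_one)
  qed
  moreover have "card (l ` {..<d}) = d"
    using inj by (simp add: card_image)
  moreover have "l ` {..<d} \<subseteq> W"
    using lW by auto
  ultimately have W_span: "W \<subseteq> span (l ` {..<d})"
    using dimW by (intro card_ge_dim_independent) auto
  define w where "w n x = (\<Sum>k<d. (x \<bullet> l k) *\<^sub>R b (r n) k)" for n x
  show thesis
  proof (rule that[of r w])
    show "strict_mono r" by fact
    show "w n x \<in> V (r n)" for n x
      unfolding w_def using bV V by (auto intro!: subspace_sum subspace_scale)
    fix x assume "x \<in> W"
    then have "x \<in> span (l ` {..<d})"
      using W_span by blast
    then have "x = (\<Sum>k<d. (x \<bullet> l k) *\<^sub>R l k)"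
    proof (induction rule: span_induct_alt)
      case base
      show ?case by simp
    next
      case (step c y z)
      then obtain j where j: "j < d" "y = l j" by auto
      have "(\<Sum>k<d. (y \<bullet> l k) *\<^sub>R l k) = (\<Sum>k<d. if k = j then l j else 0)"
        using j lortho by (intro sum.cong) auto
      also have "\<dots> = y"
        using j by simp
      finally have y: "(\<Sum>k<d. (y \<bullet> l k) *\<^sub>R l k) = y" .
      have "(\<Sum>k<d. ((c *\<^sub>R y + z) \<bullet> l k) *\<^sub>R l k) =
          c *\<^sub>R (\<Sum>k<d. (y \<bullet> l k) *\<^sub>R l k) + (\<Sum>k<d. (z \<bullet> l k) *\<^sub>R l k)"
        by (simp add: inner_left_distrib scaleR_left_distrib sum.distrib scaleR_right.sum)
      then show ?case
        using step y by simp
    qed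
    moreover have "(\<lambda>n. w n x) \<longlonglongrightarrow> (\<Sum>k<d. (x \<bullet> l k) *\<^sub>R l k)"
      unfolding w_def using l by (intro tendsto_intros) auto
    ultimately show "(\<lambda>n. w n x) \<longlonglongrightarrow> x"
      by simp
  qed
qed

section \<open>Matrices diagonal in a frame\<close>

definition diag_in :: "'m::finite mat \<Rightarrow> complex^'m \<Rightarrow> 'm mat"
  where "diag_in P d = P ** (\<chi> i j. if i = j then d $ i else 0) ** matrix_inv P"

lemma matrix_inv_inverse:
  fixes P :: "complex^'n^'n"
  assumes "det P \<noteq> 0"
  shows "P ** matrix_inv P = mat 1" "matrix_inv P ** P = mat 1"
proof -
  have "\<exists>P'. P ** P' = mat 1 \<and> P' ** P = mat 1"
    using assms invertible_det_nz[of P] by (simp add: invertible_def)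
  then have "P ** matrix_inv P = mat 1 \<and> matrix_inv P ** P = mat 1"
    unfolding matrix_inv_def by (rule someI_ex)
  then show "P ** matrix_inv P = mat 1" "matrix_inv P ** P = mat 1"
    by auto
qed

lemma diag_in_column:
  assumes "det P \<noteq> 0"
  shows "diag_in P d *v column s P = d $ s *s column s P"
proof -
  let ?D = "\<chi> i j. if i = j then d $ i else 0"
  have "diag_in P d ** P = P ** ?D"
    by (simp add: diag_in_def matrix_mul_assoc[symmetric] matrix_inv_inverse[OF assms])
  moreover have "(diag_in P d ** P) *v axis s 1 = diag_in P d *v column s P"
    by (simp flip: matrix_vector_axis matrix_vector_mul_assoc)
  moreover have "(P ** ?D) *v axis s 1 = d $ s *s column s P"
    by (simp add: matrix_vector_axis)
      (simp add: column_def matrix_matrix_mult_def vec_eq_iff if_distrib mult.commute cong: if_cong)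
  ultimately show ?thesis by simp
qed

lemma inj_diag_in:
  assumes "det P \<noteq> 0"
  shows "inj (diag_in P)"
proof (rule injI)
  fix d d' assume eq: "diag_in P d = diag_in P d'"
  have "d $ s = d' $ s" for s
  proof -
    have "column s P \<noteq> 0"
      using assms det_zero_column[of s P] by auto
    moreover have "d $ s *s column s P = d' $ s *s column s P"
      using diag_in_column[OF assms, of _ s] eq by metis
    ultimately show ?thesis
      by simp
  qed
  then show "d = d'"
    by (simp add: vec_eq_iff)
qed

lemma linear_diag_in: "linear (diag_in P)"
proof (rule linearI)
  show "diag_in P (c + d) = diag_in P c + diag_in P d" for c d
  proof -
    have "(\<chi> i j. if i = j then (c + d) $ i else 0) =
        (\<chi> i j. if i = j then c $ i else 0) + (\<chi> i j. if i = j then d $ i else 0)"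
      by (simp add: vec_eq_iff)
    then show ?thesis
      unfolding diag_in_def by (simp add: matrix_add_ldistrib matrix_matrix_add_rdistrib)
  qed
  show "diag_in P (r *\<^sub>R d) = r *\<^sub>R diag_in P d" for r d
  proof -
    have "(\<chi> i j. if i = j then (r *\<^sub>R d) $ i else 0) = r *\<^sub>R (\<chi> i j. if i = j then d $ i else 0)"
      by (simp add: vec_eq_iff)
    then show ?thesis
      unfolding diag_in_def
      by (simp add: matrix_matrix_mult_def vec_eq_iff flip: scaleR_right.sum)
  qed
qed

section \<open>The 111-algebra as a limit of diagonal algebras\<close>

definition frame_tensor :: "'m::finite mat \<Rightarrow> 'm mat \<Rightarrow> 'm mat \<Rightarrow> 'm tensor"
  where "frame_tensor P Q R = (\<Sum>s\<in>UNIV. tensor_prod (column s P) (column s Q) (column s R))"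

definition frame_diagonal ::
  "'m::finite mat \<Rightarrow> 'm mat \<Rightarrow> 'm mat \<Rightarrow> complex^'m \<Rightarrow> 'm triple"
  where "frame_diagonal P Q R d = (diag_in P d, diag_in Q d, diag_in R d)"

lemma act_tensor_prod:
  "act_A X (tensor_prod a b c) = tensor_prod (X *v a) b c"
  "act_B X (tensor_prod a b c) = tensor_prod a (X *v b) c"
  "act_C X (tensor_prod a b c) = tensor_prod a b (X *v c)"
  by (simp_all add: act_A_def act_B_def act_C_def tensor_prod_def vec_eq_iff
      matrix_vector_mult_def sum_distrib_left sum_distrib_right mult_ac)

lemma act_sum:
  "act_A X (\<Sum>s\<in>S. t s) = (\<Sum>s\<in>S. act_A X (t s))"
  "act_B X (\<Sum>s\<in>S. t s) = (\<Sum>s\<in>S. act_B X (t s))"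
  "act_C X (\<Sum>s\<in>S. t s) = (\<Sum>s\<in>S. act_C X (t s))"
  by (induction S rule: infinite_finite_induct)
    (simp_all add: act_A_def act_B_def act_C_def vec_eq_iff distrib_left sum.distrib)

lemma tensor_prod_scale:
  "tensor_prod (c *s x) y z = tensor_scale c (tensor_prod x y z)"
  "tensor_prod x (c *s y) z = tensor_scale c (tensor_prod x y z)"
  "tensor_prod x y (c *s z) = tensor_scale c (tensor_prod x y z)"
  by (simp_all add: tensor_prod_def tensor_scale_def vec_eq_iff mult_ac)

text \<open>
  An operator diagonal in the first frame multiplies the summand \<open>s\<close> by its eigenvalue, and
  so does the operator with the same eigenvalues in each of the other two frames.
\<close>

lemma frame_diagonal_in_algebra:
  assumes "det P \<noteq> 0" "det Q \<noteq> 0" "det R \<noteq> 0"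
  shows "frame_diagonal P Q R d \<in> algebra_111 (frame_tensor P Q R)"
  by (simp add: frame_diagonal_def algebra_111_def frame_tensor_def act_sum act_tensor_prod
      diag_in_column assms tensor_prod_scale)

text \<open>
  Dimensions are taken over \<open>\<real>\<close>, for which inner products and orthonormal bases are available;
  hence the factor \<open>2\<close>.
\<close>

lemma frame_diagonal_subspace:
  fixes P Q R :: "'m::finite mat"
  assumes "det P \<noteq> 0" "det Q \<noteq> 0" "det R \<noteq> 0"
  shows "subspace (range (frame_diagonal P Q R))"
    and "dim (range (frame_diagonal P Q R)) = 2 * CARD('m)"
proof -
  have lin: "linear (frame_diagonal P Q R)"
    using linear_diag_in[of P] linear_diag_in[of Q] linear_diag_in[of R]
    unfolding frame_diagonal_def
    by (auto intro!: linearI simp: linear_add linear_scale)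
  have inj: "inj (frame_diagonal P Q R)"
    using inj_diag_in[OF assms(1)] by (auto simp: inj_on_def frame_diagonal_def)
  show "subspace (range (frame_diagonal P Q R))"
    using lin by (rule linear_subspace_image) simp
  have "dim (range (frame_diagonal P Q R)) = dim (UNIV :: (complex^'m) set)"
    using lin inj by (intro dim_image_eq) simp_all
  then show "dim (range (frame_diagonal P Q R)) = 2 * CARD('m)"
    by simp
qed

text \<open>
  A complex basis together with its multiples by \<open>\<i>\<close> spans over \<open>\<real>\<close>.
\<close>

lemma algebra_111_real_subspace:
  fixes T :: "'m::finite tensor"
  assumes "unital_basis_111 T e"
  shows "subspace (algebra_111 T)" and "dim (algebra_111 T) \<le> 2 * CARD('m)"
proof -
  define B where "B = e ` {..<CARD('m)}"
  define B' where "B' = B \<union> triple_scale \<i> ` B"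
  have alg: "algebra_111 T = ctriple.span B"
    using assms by (simp add: unital_basis_111_def B_def)
  have scaleR: "r *\<^sub>R x = triple_scale (complex_of_real r) x" for r and x :: "'m triple"
    by (cases x) (simp add: triple_scale_def mat_scale_def vec_eq_iff complex_eq_iff)
  show "subspace (algebra_111 T)"
    unfolding alg subspace_def
    by (simp add: scaleR ctriple.span_zero ctriple.span_add ctriple.span_scale)
  have sc: "triple_scale c b \<in> span B'" if "b \<in> B" for c b
  proof -
    have "triple_scale c b = Re c *\<^sub>R b + Im c *\<^sub>R triple_scale \<i> b"
      by (cases b) (simp add: triple_scale_def mat_scale_def vec_eq_iff complex_eq_iff)
    moreover have "b \<in> B'" "triple_scale \<i> b \<in> B'"
      using that by (auto simp: B'_def)
    ultimately show ?thesis
      by (simp add: span_add span_scale span_base)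
  qed
  have "x \<in> span B'" if "x \<in> ctriple.span B" for x
    using that
    by (induction rule: ctriple.span_induct_alt) (auto simp: span_zero intro: span_add sc)
  then have "dim (algebra_111 T) \<le> card B'"
    unfolding alg by (intro dim_le_card) (auto simp: B'_def B_def)
  also have "\<dots> \<le> card B + card (triple_scale \<i> ` B)"
    unfolding B'_def by (rule card_Un_le)
  also have "\<dots> \<le> card B + card B"
    by (intro add_left_mono card_image_le) (simp add: B_def)
  also have "card B \<le> CARD('m)"
    unfolding B_def using card_image_le[of "{..<CARD('m)}" e] by simp
  finally show "dim (algebra_111 T) \<le> 2 * CARD('m)" by simp
qed

lemma sums_of_rank_one_subset_frame_tensors:
  "sums_of_rank_one CARD('m) \<subseteq> range (\<lambda>(P, Q, R). frame_tensor P Q (R :: 'm::finite mat))"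
proof
  fix T :: "'m tensor" assume "T \<in> sums_of_rank_one CARD('m)"
  then obtain t where T: "T = (\<Sum>s<CARD('m). t s)" and t: "\<forall>s<CARD('m). rank_one (t s)"
    by (auto simp: sums_of_rank_one_def)
  then obtain a b c where abc: "\<And>s. s < CARD('m) \<Longrightarrow> t s = tensor_prod (a s) (b s) (c s)"
    unfolding rank_one_def by metis
  obtain h :: "'m \<Rightarrow> nat" where h: "bij_betw h UNIV {0..<CARD('m)}"
    using ex_bij_betw_finite_nat[of "UNIV :: 'm set"] by auto
  have "T = (\<Sum>s\<in>UNIV. t (h s))"
    unfolding T using sum.reindex_bij_betw[OF h, of t] by (simp add: atLeast0LessThan)
  also have "\<dots> = (\<Sum>s\<in>UNIV. tensor_prod (a (h s)) (b (h s)) (c (h s)))"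
    using h by (intro sum.cong refl abc) (auto simp: bij_betw_def)
  also have "\<dots> = frame_tensor (\<chi> i s. a (h s) $ i) (\<chi> i s. b (h s) $ i) (\<chi> i s. c (h s) $ i)"
    by (simp add: frame_tensor_def column_def)
  finally show "T \<in> range (\<lambda>(P, Q, R). frame_tensor P Q R)"
    by (metis case_prod_conv rangeI)
qed

text \<open>
  The border rank is a least number with a certain property, so it is meaningful only once some
  number is known to have it. The zero coordinates of \<open>T\<close> are left out because a zero summand is not
  of rank one.
\<close>

lemma rank_one_decomposition_exists:
  fixes T :: "'m::finite tensor"
  shows "\<exists>r. T \<in> sums_of_rank_one r"
proof -
  define S where "S = {(i, j, k). T $ i $ j $ k \<noteq> 0}"
  define u where "u = (\<lambda>(i, j, k). tensor_prod (axis i (T $ i $ j $ k)) (axis j 1) (axis k 1))"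
  have fin: "finite S"
    by simp
  then obtain h where h: "bij_betw h {0..<card S} S"
    using ex_bij_betw_nat_finite by blast
  have u_coord: "u (a, b, c) $ i $ j $ k = (if (a, b, c) = (i, j, k) then T $ i $ j $ k else 0)"
    for a b c i j k
    by (auto simp: u_def tensor_prod_def axis_def)
  have "(\<Sum>s\<in>S. u s) $ i $ j $ k = T $ i $ j $ k" for i j k
  proof -
    have "(\<Sum>s\<in>S. u s) $ i $ j $ k = (\<Sum>s\<in>S. if s = (i, j, k) then T $ i $ j $ k else 0)"
      unfolding sum_component by (intro sum.cong) (auto simp: u_coord split: if_splits)
    also have "\<dots> = T $ i $ j $ k"
      by (simp add: S_def)
    finally show ?thesis .
  qed
  then have "T = (\<Sum>s\<in>S. u s)"
    by (simp add: vec_eq_iff)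
  also have "\<dots> = (\<Sum>s<card S. u (h s))"
    using sum.reindex_bij_betw[OF h, of u] by (simp add: atLeast0LessThan)
  finally have "T = (\<Sum>s<card S. u (h s))" .
  moreover have "rank_one (u (h s))" if "s < card S" for s
  proof -
    obtain i j k where hs: "h s = (i, j, k)"
      by (metis prod_cases3)
    have "h s \<in> S"
      using h that by (auto simp: bij_betw_def)
    then have "T $ i $ j $ k \<noteq> 0"
      by (simp add: S_def hs)
    moreover have "u (h s) = tensor_prod (axis i (T $ i $ j $ k)) (axis j 1) (axis k 1)"
      by (simp add: u_def hs)
    ultimately show ?thesis
      unfolding rank_one_def by (metis axis_eq_0_iff one_neq_zero)
  qed
  ultimately have "T \<in> sums_of_rank_one (card S)"
    unfolding sums_of_rank_one_def by (intro CollectI exI[of _ "\<lambda>s. u (h s)"]) auto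
  then show ?thesis ..
qed

lemma minimal_border_rank_closure:
  fixes T :: "'m::finite tensor"
  assumes "minimal_border_rank T"
  shows "T \<in> closure (sums_of_rank_one CARD('m))"
proof -
  have "\<exists>r. T \<in> closure (sums_of_rank_one r)"
    using rank_one_decomposition_exists[of T] closure_subset by blast
  then have "T \<in> closure (sums_of_rank_one (border_rank T))"
    unfolding border_rank_def by (rule LeastI_ex)
  then show ?thesis
    using assms by (simp add: minimal_border_rank_def)
qed

text \<open>
  The tensor of a triple of matrices depends continuously on the triple, and triples of
  invertible matrices are dense; so sums of \<open>m\<close> rank one tensors are limits of tensors of frames.
\<close>

lemma minimal_border_rank_limit_of_frames:
  fixes T :: "'m::finite tensor"
  assumes "minimal_border_rank T"
  shows "\<exists>P Q R. (\<forall>n. det (P n) \<noteq> 0 \<and> det (Q n) \<noteq> 0 \<and> det (R n) \<noteq> 0) \<and>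
    (\<lambda>n. frame_tensor (P n) (Q n) (R n)) \<longlonglongrightarrow> T"
proof -
  let ?G = "{A :: 'm mat. det A \<noteq> 0}"
  let ?f = "\<lambda>(P, Q, R). frame_tensor P Q (R :: 'm mat)"
  have cont: "continuous_on UNIV ?f"
    unfolding frame_tensor_def tensor_prod_def column_def case_prod_beta
    by (intro continuous_intros)
  have dense: "closure (?G \<times> ?G \<times> ?G) = UNIV"
    by (simp add: closure_Times closure_invertible_matrices)
  have "range ?f \<subseteq> closure (?f ` (?G \<times> ?G \<times> ?G))"
    using continuous_image_closure_subset[OF cont, of "?G \<times> ?G \<times> ?G"] by (simp add: dense)
  then have "closure (sums_of_rank_one CARD('m)) \<subseteq> closure (?f ` (?G \<times> ?G \<times> ?G))"
    by (intro closure_minimal order_trans[OF sums_of_rank_one_subset_frame_tensors] closed_closure)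
  then have "T \<in> closure (?f ` (?G \<times> ?G \<times> ?G))"
    using minimal_border_rank_closure[OF assms] by blast
  then obtain t where t: "\<And>n. t n \<in> ?f ` (?G \<times> ?G \<times> ?G)" and lim: "t \<longlonglongrightarrow> T"
    by (auto simp: closure_sequential)
  have "\<exists>P Q R. det P \<noteq> 0 \<and> det Q \<noteq> 0 \<and> det R \<noteq> 0 \<and> t n = frame_tensor P Q R" for n
    using t[of n] by auto
  then obtain P Q R where "\<And>n. det (P n) \<noteq> 0" "\<And>n. det (Q n) \<noteq> 0" "\<And>n. det (R n) \<noteq> 0"
      "\<And>n. t n = frame_tensor (P n) (Q n) (R n)"
    by metis
  moreover from this(4) have "t = (\<lambda>n. frame_tensor (P n) (Q n) (R n))"
    by blast
  ultimately show ?thesis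
    using lim by blast
qed

text \<open>
  The equations of the 111-algebra are continuous in the triple and the tensor jointly.
\<close>

lemma algebra_111_closed:
  assumes "x \<longlonglongrightarrow> y" and "t \<longlonglongrightarrow> T" and "\<And>n. x n \<in> algebra_111 (t n)"
  shows "y \<in> algebra_111 T"
proof -
  have x1: "(\<lambda>n. fst (x n)) \<longlonglongrightarrow> fst y" and x2: "(\<lambda>n. fst (snd (x n))) \<longlonglongrightarrow> fst (snd y)"
    and x3: "(\<lambda>n. snd (snd (x n))) \<longlonglongrightarrow> snd (snd y)"
    using assms(1) by (auto intro: tendsto_intros)
  have A: "(\<lambda>n. act_A (fst (x n)) (t n)) \<longlonglongrightarrow> act_A (fst y) T"
    unfolding act_A_def by (intro tendsto_intros x1 assms(2))
  have B: "(\<lambda>n. act_B (fst (snd (x n))) (t n)) \<longlonglongrightarrow> act_B (fst (snd y)) T"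
    unfolding act_B_def by (intro tendsto_intros x2 assms(2))
  have C: "(\<lambda>n. act_C (snd (snd (x n))) (t n)) \<longlonglongrightarrow> act_C (snd (snd y)) T"
    unfolding act_C_def by (intro tendsto_intros x3 assms(2))
  have "act_A (fst (x n)) (t n) = act_B (fst (snd (x n))) (t n)"
    and BC: "act_B (fst (snd (x n))) (t n) = act_C (snd (snd (x n))) (t n)" for n
    using assms(3)[of n] by (auto simp: algebra_111_def)
  then have "act_A (fst y) T = act_B (fst (snd y)) T"
    using LIMSEQ_unique[OF A] B by simp
  moreover have "act_B (fst (snd y)) T = act_C (snd (snd y)) T"
    using LIMSEQ_unique[OF B] C by (simp add: BC)
  ultimately show ?thesis
    by (auto simp: algebra_111_def case_prod_beta)
qed

text \<open>
  The diagonal subspaces of the approximating tensors have the full dimension \<open>m\<close> of the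
  111-algebra of the limit, so nothing of that algebra is lost in the limit.
\<close>

lemma algebra_111_limit_of_diagonal_algebras:
  fixes T :: "'m::finite tensor"
  assumes "minimal_border_rank T" and "unital_basis_111 T e"
  shows "\<exists>P Q R d. (\<forall>n. det (P n) \<noteq> 0 \<and> det (Q n) \<noteq> 0 \<and> det (R n) \<noteq> 0) \<and>
    (\<forall>x\<in>algebra_111 T. (\<lambda>n. frame_diagonal (P n) (Q n) (R n) (d n x)) \<longlonglongrightarrow> x)"
proof -
  obtain P Q R where det': "\<forall>n. det (P n) \<noteq> 0 \<and> det (Q n) \<noteq> 0 \<and> det (R n) \<noteq> 0"
    and lim: "(\<lambda>n. frame_tensor (P n) (Q n) (R n)) \<longlonglongrightarrow> T"
    using minimal_border_rank_limit_of_frames[OF assms(1)] by (elim exE conjE) (rule that)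
  then have det: "det (P n) \<noteq> 0" "det (Q n) \<noteq> 0" "det (R n) \<noteq> 0" for n
    by auto
  define V where "V n = range (frame_diagonal (P n) (Q n) (R n))" for n
  obtain r w where r: "strict_mono (r :: nat \<Rightarrow> nat)" and w: "\<And>n x. w n x \<in> V (r n)"
    and w_lim: "\<And>x. x \<in> algebra_111 T \<Longrightarrow> (\<lambda>n. w n x) \<longlonglongrightarrow> x"
  proof (rule subspaces_exhaust_limit[of V "2 * CARD('m)" "algebra_111 T"])
    show "subspace (V n)" "dim (V n) = 2 * CARD('m)" for n
      unfolding V_def by (rule frame_diagonal_subspace[OF det])+
    show "subspace (algebra_111 T)" "dim (algebra_111 T) \<le> 2 * CARD('m)"
      using algebra_111_real_subspace[OF assms(2)] .
    fix r v l assume r: "strict_mono (r :: nat \<Rightarrow> nat)" and v: "\<And>n. v n \<in> V (r n)" and "v \<longlonglongrightarrow> l"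
    show "l \<in> algebra_111 T"
    proof (rule algebra_111_closed)
      show "v \<longlonglongrightarrow> l" by fact
      show "(\<lambda>n. frame_tensor (P (r n)) (Q (r n)) (R (r n))) \<longlonglongrightarrow> T"
        using LIMSEQ_subseq_LIMSEQ[OF lim r] by (simp add: o_def)
      show "v n \<in> algebra_111 (frame_tensor (P (r n)) (Q (r n)) (R (r n)))" for n
        using v[of n] unfolding V_def by (rule rangeE) (simp add: frame_diagonal_in_algebra[OF det])
    qed
  qed blast
  have "\<exists>d. w n x = frame_diagonal (P (r n)) (Q (r n)) (R (r n)) d" for n x
    using w[of n x] unfolding V_def by (rule rangeE) (rule exI)
  then obtain d where "\<And>n x. w n x = frame_diagonal (P (r n)) (Q (r n)) (R (r n)) (d n x)"
    by metis
  then show ?thesis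
    using det w_lim
    by (intro exI[of _ "\<lambda>n. P (r n)"] exI[of _ "\<lambda>n. Q (r n)"] exI[of _ "\<lambda>n. R (r n)"] exI[of _ d])
      simp
qed

section \<open>Modules given by commuting tuples of matrices\<close>

text \<open>
  The list of variables is a parameter, so that statements can be proved by induction on it.
\<close>

definition monomial_eval :: "(nat \<Rightarrow> 'm::finite mat) \<Rightarrow> (nat \<Rightarrow>\<^sub>0 nat) \<Rightarrow> nat list \<Rightarrow> 'm mat"
  where "monomial_eval X u xs =
    foldr (\<lambda>i. ((**) (X i)) ^^ Poly_Mapping.lookup u i) xs (mat 1)"

text \<open>
  Passing to the underlying finitely supported functions makes it possible to split a polynomial
  into its terms.
\<close>

definition poly_eval ::
  "(nat \<Rightarrow> 'm::finite mat) \<Rightarrow> ((nat \<Rightarrow>\<^sub>0 nat) \<Rightarrow>\<^sub>0 complex) \<Rightarrow> 'm mat"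
  where "poly_eval X p = (\<Sum>u\<in>Poly_Mapping.keys p.
    mat_scale (Poly_Mapping.lookup p u) (monomial_eval X u [1..<CARD('m)]))"

definition commuting :: "(nat \<Rightarrow> 'm::finite mat) \<Rightarrow> bool"
  where "commuting X \<longleftrightarrow>
    (\<forall>i\<in>{1..<CARD('m)}. \<forall>j\<in>{1..<CARD('m)}. X i ** X j = X j ** X i)"

lemma mat_eval_eq: "mat_eval X p = poly_eval X (Rep_poly_ring p)"
  by (simp add: mat_eval_def poly_eval_def monomial_eval_def)

lemma funpow_matrix_mult_assoc:
  fixes A B C :: "'m::finite mat"
  shows "((**) A ^^ k) (B ** C) = ((**) A ^^ k) B ** C"
  by (induction k) (simp_all add: matrix_mul_assoc)

lemma funpow_matrix_mult_commute:
  fixes A B C :: "'m::finite mat"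
  assumes "C ** A = A ** C"
  shows "((**) A ^^ k) (C ** B) = C ** ((**) A ^^ k) B"
  by (induction k) (simp_all add: matrix_mul_assoc assms)

lemma monomial_eval_commute:
  assumes "\<And>i. i \<in> set xs \<Longrightarrow> C ** X i = X i ** C"
  shows "C ** monomial_eval X u xs = monomial_eval X u xs ** C"
  using assms
proof (induction xs)
  case Nil
  show ?case by (simp add: monomial_eval_def)
next
  case (Cons i xs)
  let ?p = "(**) (X i) ^^ Poly_Mapping.lookup u i"
  have "C ** ?p (monomial_eval X u xs) = ?p (C ** monomial_eval X u xs)"
    using Cons.prems by (simp add: funpow_matrix_mult_commute)
  also have "\<dots> = ?p (monomial_eval X u xs) ** C"
    using Cons by (simp add: funpow_matrix_mult_assoc)
  finally show ?case
    by (simp add: monomial_eval_def)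
qed

text \<open>
  The factors of \<open>u\<close> and \<open>v\<close> are interleaved on the left-hand side; they are separated by moving
  the power of \<open>X i\<close> that comes from \<open>v\<close> past the remaining factors of \<open>u\<close>.
\<close>

lemma monomial_eval_add:
  assumes "\<And>i j. i \<in> set xs \<Longrightarrow> j \<in> set xs \<Longrightarrow> X i ** X j = X j ** X i"
  shows "monomial_eval X (u + v) xs = monomial_eval X u xs ** monomial_eval X v xs"
  using assms
proof (induction xs)
  case Nil
  show ?case by (simp add: monomial_eval_def)
next
  case (Cons i xs)
  let ?M = "\<lambda>u. monomial_eval X u xs"
  let ?p = "\<lambda>u. (**) (X i) ^^ Poly_Mapping.lookup u i"
  have "?M u ** X i = X i ** ?M u"
    using Cons.prems by (intro monomial_eval_commute[symmetric]) auto
  then have "?p v (?M u ** ?M v) = ?M u ** ?p v (?M v)"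
    by (rule funpow_matrix_mult_commute)
  then have "?p u (?p v (?M u ** ?M v)) = ?p u (?M u) ** ?p v (?M v)"
    by (simp add: funpow_matrix_mult_assoc)
  moreover have "?M (u + v) = ?M u ** ?M v"
    using Cons by simp
  ultimately show ?case
    by (simp add: monomial_eval_def lookup_add funpow_add)
qed

lemma mat_scale_matrix_mult:
  "mat_scale a M ** mat_scale b N = mat_scale (a * b) (M ** N)"
  by (simp add: mat_scale_def matrix_matrix_mult_def vec_eq_iff sum_distrib_left mult_ac)

lemma mat_scale_vector_mult: "mat_scale a M *v x = a *s (M *v x)"
  by (simp add: mat_scale_def matrix_vector_mult_def vec_eq_iff sum_distrib_left mult_ac)

lemma sum_matrix_mult_left:
  fixes N :: "'m::finite mat"
  shows "(\<Sum>s\<in>S. M s) ** N = (\<Sum>s\<in>S. M s ** N)"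
  by (induction S rule: infinite_finite_induct) (simp_all add: matrix_matrix_add_rdistrib)

lemma sum_matrix_mult_right:
  fixes N :: "'m::finite mat"
  shows "N ** (\<Sum>s\<in>S. M s) = (\<Sum>s\<in>S. N ** M s)"
  by (induction S rule: infinite_finite_induct) (simp_all add: matrix_add_ldistrib)

lemma sum_matrix_vector_mult:
  fixes x :: "complex^'m::finite"
  shows "(\<Sum>s\<in>S. M s) *v x = (\<Sum>s\<in>S. M s *v x)"
  by (induction S rule: infinite_finite_induct) (simp_all add: matrix_vector_mult_add_rdistrib)

lemma poly_eval_superset:
  fixes X :: "nat \<Rightarrow> 'm::finite mat"
  assumes "finite U" "Poly_Mapping.keys p \<subseteq> U"
  shows "poly_eval X p = (\<Sum>u\<in>U.
    mat_scale (Poly_Mapping.lookup p u) (monomial_eval X u [1..<CARD('m)]))"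
  unfolding poly_eval_def using assms
  by (intro sum.mono_neutral_left) (auto simp: in_keys_iff)

lemma poly_eval_add: "poly_eval X (p + q) = poly_eval X p + poly_eval X q"
proof -
  let ?U = "Poly_Mapping.keys p \<union> Poly_Mapping.keys q"
  have "poly_eval X p + poly_eval X q = (\<Sum>u\<in>?U.
      mat_scale (Poly_Mapping.lookup (p + q) u) (monomial_eval X u [1..<CARD('a)]))"
    by (simp add: poly_eval_superset[of ?U] lookup_add cmat.scale_left_distrib sum.distrib)
  then show ?thesis
    using keys_add[of p q] by (simp add: poly_eval_superset[of ?U])
qed

lemma poly_eval_sum: "poly_eval X (\<Sum>s\<in>S. p s) = (\<Sum>s\<in>S. poly_eval X (p s))"
proof (induction S rule: infinite_finite_induct)
  case (insert s S)
  then show ?case by (simp add: poly_eval_add)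
qed (simp_all add: poly_eval_def)

lemma poly_eval_single:
  fixes X :: "nat \<Rightarrow> 'm::finite mat"
  shows "poly_eval X (Poly_Mapping.single u c) =
    mat_scale c (monomial_eval X u [1..<CARD('m)])"
  by (simp add: poly_eval_superset[of "{u}"])

lemma poly_mapping_sum_singles:
  "p = (\<Sum>u\<in>Poly_Mapping.keys p. Poly_Mapping.single u (Poly_Mapping.lookup p u))"
  by (rule poly_mapping_eqI)
    (auto simp: lookup_sum lookup_single when_def in_keys_iff)

lemma poly_eval_mult:
  assumes "commuting X"
  shows "poly_eval X (p * q) = poly_eval X p ** poly_eval X q"
proof -
  let ?xs = "[1..<CARD('a)]"
  have mono: "monomial_eval X (u + v) ?xs = monomial_eval X u ?xs ** monomial_eval X v ?xs" for u v
    using assms by (intro monomial_eval_add) (auto simp: commuting_def)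
  have "p * q = (\<Sum>u\<in>Poly_Mapping.keys p. \<Sum>v\<in>Poly_Mapping.keys q.
      Poly_Mapping.single (u + v) (Poly_Mapping.lookup p u * Poly_Mapping.lookup q v))"
    by (subst poly_mapping_sum_singles[of p], subst poly_mapping_sum_singles[of q])
      (simp add: sum_product mult_single)
  then have "poly_eval X (p * q) = (\<Sum>u\<in>Poly_Mapping.keys p. \<Sum>v\<in>Poly_Mapping.keys q.
      mat_scale (Poly_Mapping.lookup p u) (monomial_eval X u ?xs) **
      mat_scale (Poly_Mapping.lookup q v) (monomial_eval X v ?xs))"
    by (simp only: poly_eval_sum poly_eval_single mono mat_scale_matrix_mult)
  also have "\<dots> = (\<Sum>u\<in>Poly_Mapping.keys p.
      mat_scale (Poly_Mapping.lookup p u) (monomial_eval X u ?xs) ** poly_eval X q)"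
    by (simp only: poly_eval_def sum_matrix_mult_right)
  also have "\<dots> = poly_eval X p ** poly_eval X q"
    by (simp only: poly_eval_def[of X p] sum_matrix_mult_left)
  finally show ?thesis .
qed

lemma mat_eval_const: "mat_eval X (poly_const c) = mat_scale c (mat 1)"
proof -
  have "foldr (\<lambda>i. ((**) (X i)) ^^ Poly_Mapping.lookup 0 i) xs (mat 1) = mat 1" for xs
    by (induction xs) simp_all
  then show ?thesis
    by (simp add: mat_eval_eq poly_const.rep_eq poly_eval_single monomial_eval_def)
qed

lemma module_mat_eval:
  assumes "commuting X"
  shows "module (\<lambda>p a. mat_eval X p *v a)"
proof
  fix p q :: "'a poly_ring" and a b :: "complex^'a"
  show "mat_eval X p *v (a + b) = mat_eval X p *v a + mat_eval X p *v b"
    by (simp add: matrix_vector_right_distrib)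
  show "mat_eval X (p + q) *v a = mat_eval X p *v a + mat_eval X q *v a"
    by (simp add: mat_eval_eq plus_poly_ring.rep_eq poly_eval_add matrix_vector_mult_add_rdistrib)
  show "mat_eval X p *v (mat_eval X q *v a) = mat_eval X (p * q) *v a"
    by (simp add: mat_eval_eq times_poly_ring.rep_eq poly_eval_mult assms matrix_vector_mul_assoc)
  have "poly_const 1 = (1 :: 'a poly_ring)"
    by transfer (simp flip: single_one)
  then show "mat_eval X 1 *v a = a"
    using mat_eval_const[of X 1] by simp
qed

lemma tendsto_monomial_eval:
  assumes "\<And>i. i \<in> set xs \<Longrightarrow> ((\<lambda>n. X n i) \<longlongrightarrow> Y i) F"
  shows "((\<lambda>n. monomial_eval (X n) u xs) \<longlongrightarrow> monomial_eval Y u xs) F"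
  using assms
proof (induction xs)
  case Nil
  show ?case by (simp add: monomial_eval_def)
next
  case (Cons i xs)
  have "((\<lambda>n. ((**) (X n i) ^^ k) (monomial_eval (X n) u xs)) \<longlongrightarrow>
      ((**) (Y i) ^^ k) (monomial_eval Y u xs)) F" for k
    using Cons by (induction k) (auto intro: tendsto_matrix_mult)
  then show ?case
    by (simp add: monomial_eval_def)
qed

lemma tendsto_mat_eval:
  fixes Y :: "nat \<Rightarrow> 'm::finite mat"
  assumes "\<And>i. i \<in> {1..<CARD('m)} \<Longrightarrow> ((\<lambda>n. X n i) \<longlongrightarrow> Y i) F"
  shows "((\<lambda>n. mat_eval (X n) p) \<longlongrightarrow> mat_eval Y p) F"
  unfolding mat_eval_eq poly_eval_def
  by (intro tendsto_sum tendsto_mat_scale tendsto_monomial_eval assms) auto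

text \<open>
  The index \<open>0\<close> is left out of the range of \<open>i\<close> because no variable of the polynomial ring
  corresponds to the unit of the 111-algebra.
\<close>

definition common_eigenbasis :: "'m::finite mat \<Rightarrow> (nat \<Rightarrow> 'm mat) \<Rightarrow> bool"
  where "common_eigenbasis P X \<longleftrightarrow> det P \<noteq> 0 \<and>
    (\<forall>i\<in>{1..<CARD('m)}. \<forall>s. \<exists>\<mu>. X i *v column s P = \<mu> *s column s P)"

lemma monomial_eval_eigenvector:
  assumes "\<And>i. i \<in> set xs \<Longrightarrow> \<exists>\<mu>. X i *v x = \<mu> *s x"
  shows "\<exists>\<mu>. monomial_eval X u xs *v x = \<mu> *s x"
  using assms
proof (induction xs)
  case Nil
  show ?case
    by (auto simp: monomial_eval_def intro: exI[of _ 1])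
next
  case (Cons i xs)
  then obtain \<mu> where \<mu>: "X i *v x = \<mu> *s x"
    by auto
  have "\<exists>\<nu>. ((**) (X i) ^^ k) (monomial_eval X u xs) *v x = \<nu> *s x" for k
  proof (induction k)
    case 0
    then show ?case using Cons by simp
  next
    case (Suc k)
    then obtain \<nu> where "((**) (X i) ^^ k) (monomial_eval X u xs) *v x = \<nu> *s x" ..
    then have "((**) (X i) ^^ Suc k) (monomial_eval X u xs) *v x = (\<nu> * \<mu>) *s x"
      by (simp add: \<mu> matrix_vector_mul_assoc[symmetric] vector_scalar_commute)
    then show ?case ..
  qed
  then show ?case
    by (simp add: monomial_eval_def)
qed

lemma mat_eval_eigenvector:
  fixes X :: "nat \<Rightarrow> 'm::finite mat"
  assumes "\<And>i. i \<in> {1..<CARD('m)} \<Longrightarrow> \<exists>\<mu>. X i *v x = \<mu> *s x"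
  shows "\<exists>\<mu>. mat_eval X p *v x = \<mu> *s x"
proof -
  have "\<exists>\<mu>. monomial_eval X u [1..<CARD('m)] *v x = \<mu> *s x" for u
    using assms by (intro monomial_eval_eigenvector) auto
  then obtain \<mu> where "\<And>u. monomial_eval X u [1..<CARD('m)] *v x = \<mu> u *s x"
    by metis
  then have "mat_eval X p *v x =
      (\<Sum>u\<in>Poly_Mapping.keys (Rep_poly_ring p). Poly_Mapping.lookup (Rep_poly_ring p) u * \<mu> u) *s x"
    by (simp add: mat_eval_eq poly_eval_def sum_matrix_vector_mult mat_scale_vector_mult
        vec.scale_sum_left)
  then show ?thesis ..
qed

lemma common_eigenbasis_commuting:
  assumes "common_eigenbasis P X"
  shows "commuting X"
  unfolding commuting_def
proof (intro ballI)
  fix i j assume ij: "i \<in> {1..<CARD('a)}" "j \<in> {1..<CARD('a)}"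
  have "X i *v (X j *v column s P) = X j *v (X i *v column s P)" for s
  proof -
    obtain \<mu> \<nu> where "X i *v column s P = \<mu> *s column s P" "X j *v column s P = \<nu> *s column s P"
      using assms ij by (meson common_eigenbasis_def)
    then show ?thesis
      by (simp add: vector_scalar_commute mult.commute)
  qed
  then have "column s (X i ** X j ** P) = column s (X j ** X i ** P)" for s
    by (simp flip: matrix_vector_axis matrix_vector_mul_assoc)
  then have "X i ** X j ** P = X j ** X i ** P"
    by (simp add: column_def vec_eq_iff)
  moreover obtain P' where "P ** P' = mat 1"
    using assms invertible_det_nz[of P] by (auto simp: common_eigenbasis_def invertible_def)
  ultimately show "X i ** X j = X j ** X i"
    by (metis matrix_mul_assoc matrix_mul_rid)
qed

lemma commuting_limit:
  fixes Y :: "nat \<Rightarrow> 'm::finite mat"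
  assumes lim: "\<And>i. i \<in> {1..<CARD('m)} \<Longrightarrow> (\<lambda>n. X n i) \<longlonglongrightarrow> Y i"
    and "\<And>n. commuting (X n)"
  shows "commuting Y"
  unfolding commuting_def
proof (intro ballI)
  fix i j assume ij: "i \<in> {1..<CARD('m)}" "j \<in> {1..<CARD('m)}"
  have "(\<lambda>n. X n i ** X n j) \<longlonglongrightarrow> Y i ** Y j" "(\<lambda>n. X n j ** X n i) \<longlonglongrightarrow> Y j ** Y i"
    using ij by (auto intro!: tendsto_matrix_mult lim)
  moreover have "X n i ** X n j = X n j ** X n i" for n
    using assms(2)[of n] ij by (simp add: commuting_def)
  ultimately show "Y i ** Y j = Y j ** Y i"
    using LIMSEQ_unique by force
qed

section \<open>Limits of semisimple points of the Quot scheme\<close>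

abbreviation matrix_module_hom ::
  "(nat \<Rightarrow> 'm::finite mat) \<Rightarrow> (('m, 'r::finite) free_mod \<Rightarrow> complex^'m) \<Rightarrow> bool"
  where "matrix_module_hom X \<phi> \<equiv> module_hom (*s) (\<lambda>p a. mat_eval X p *v a) \<phi>"

text \<open>
  The map from the free module that sends its standard generators to the vectors \<open>v j\<close>. It makes
  sense for every tuple \<open>X\<close> on the same vectors, so a presentation of one module can be deformed
  together with the tuple.
\<close>

definition presentation ::
  "(nat \<Rightarrow> 'm::finite mat) \<Rightarrow> ('r::finite \<Rightarrow> complex^'m) \<Rightarrow> ('m, 'r) free_mod \<Rightarrow> complex^'m"
  where "presentation X v f = (\<Sum>j\<in>UNIV. mat_eval X (f $ j) *v v j)"

lemma presentation_hom:
  assumes "commuting X"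
  shows "matrix_module_hom X (presentation X v)"
proof -
  interpret M: module "\<lambda>p a. mat_eval X p *v a"
    using assms by (rule module_mat_eval)
  show ?thesis
    by unfold_locales
      (simp_all add: presentation_def M.scale_left_distrib sum.distrib M.scale_sum_right M.scale_scale
        del: matrix_vector_mul_assoc)
qed

lemma presentation_axis:
  assumes "commuting X"
  shows "presentation X v (axis j 1) = v j"
proof -
  interpret M: module "\<lambda>p a. mat_eval X p *v a"
    using assms by (rule module_mat_eval)
  have "presentation X v (axis j 1) = (\<Sum>i\<in>UNIV. if i = j then v i else 0)"
    unfolding presentation_def by (intro sum.cong) (auto simp: axis_def)
  then show ?thesis by simp
qed

lemma hom_eq_presentation:
  assumes "matrix_module_hom X \<phi>"
  shows "\<phi> f = presentation X (\<lambda>j. \<phi> (axis j 1)) f"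
proof -
  interpret module_hom "(*s)" "\<lambda>p a. mat_eval X p *v a" \<phi> by fact
  have "\<phi> f = \<phi> (\<Sum>j\<in>UNIV. f $ j *s axis j 1)"
    by (simp only: basis_expansion)
  also have "\<dots> = presentation X (\<lambda>j. \<phi> (axis j 1)) f"
    by (simp add: sum scale presentation_def)
  finally show ?thesis .
qed

text \<open>
  This matrix decides whether the \<open>b h\<close> give a basis of the quotient by the kernel of \<open>\<phi>\<close>, and its
  inverse computes coordinates in that basis.
\<close>

definition image_matrix ::
  "(('m::finite, 'r::finite) free_mod \<Rightarrow> complex^'m) \<Rightarrow> ('m \<Rightarrow> ('m, 'r) free_mod) \<Rightarrow> 'm mat"
  where "image_matrix \<phi> b = (\<chi> i h. \<phi> (b h) $ i)"

lemma hom_combination: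
  assumes "matrix_module_hom X \<phi>"
  shows "\<phi> (\<Sum>h\<in>UNIV. poly_const (c $ h) *s b h) = image_matrix \<phi> b *v c"
proof -
  interpret module_hom "(*s)" "\<lambda>p a. mat_eval X p *v a" \<phi> by fact
  have "\<phi> (\<Sum>h\<in>UNIV. poly_const (c $ h) *s b h) = (\<Sum>h\<in>UNIV. c $ h *s \<phi> (b h))"
    by (simp add: sum scale mat_eval_const mat_scale_vector_mult)
  then show ?thesis
    by (simp add: image_matrix_def matrix_vector_mult_def vec_eq_iff mult.commute)
qed

lemma combination_in_kernel_iff:
  assumes "matrix_module_hom X \<phi>"
  shows "f - (\<Sum>h\<in>UNIV. poly_const (c $ h) *s b h) \<in> {f. \<phi> f = 0} \<longleftrightarrow>
    image_matrix \<phi> b *v c = \<phi> f"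
proof -
  interpret module_hom "(*s)" "\<lambda>p a. mat_eval X p *v a" \<phi> by fact
  show ?thesis
    by (auto simp: diff hom_combination[OF assms])
qed

lemma quotient_basis_kernel_iff:
  assumes "matrix_module_hom X \<phi>"
  shows "quotient_basis {f. \<phi> f = 0} b \<longleftrightarrow> det (image_matrix \<phi> b) \<noteq> 0"
proof
  interpret module_hom "(*s)" "\<lambda>p a. mat_eval X p *v a" \<phi> by fact
  assume "quotient_basis {f. \<phi> f = 0} b"
  then have "\<exists>!c. image_matrix \<phi> b *v c = \<phi> 0"
    unfolding quotient_basis_def combination_in_kernel_iff[OF assms] by blast
  then have "\<forall>c. image_matrix \<phi> b *v c = 0 \<longrightarrow> c = 0"
    by (metis zero matrix_vector_mult_0_right)
  then show "det (image_matrix \<phi> b) \<noteq> 0"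
    by (simp add: invertible_det_nz[symmetric] invertible_left_inverse matrix_left_invertible_ker)
next
  assume "det (image_matrix \<phi> b) \<noteq> 0"
  then show "quotient_basis {f. \<phi> f = 0} b"
    unfolding quotient_basis_def combination_in_kernel_iff[OF assms] by (simp add: cramer)
qed

lemma quotient_coords_kernel:
  assumes "matrix_module_hom X \<phi>" and "det (image_matrix \<phi> b) \<noteq> 0"
  shows "image_matrix \<phi> b *v quotient_coords b {f. \<phi> f = 0} f = \<phi> f"
proof -
  have "\<exists>!c. image_matrix \<phi> b *v c = \<phi> f"
    using assms(2) by (simp add: cramer)
  then show ?thesis
    unfolding quotient_coords_def combination_in_kernel_iff[OF assms(1)] by (rule theI')
qed

lemma kernel_in_quot_points:
  assumes "matrix_module_hom X \<phi>" and "surj \<phi>"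
  shows "{f. \<phi> f = 0} \<in> quot_points"
proof -
  interpret module_hom "(*s)" "\<lambda>p a. mat_eval X p *v a" \<phi> by fact
  have "\<forall>h. \<exists>f. \<phi> f = axis h 1"
    using assms(2) by (metis surjD)
  then obtain b where "\<And>h. \<phi> (b h) = axis h 1"
    by metis
  then have "image_matrix \<phi> b = mat 1"
    by (auto simp: image_matrix_def mat_def axis_def vec_eq_iff)
  then have "quotient_basis {f. \<phi> f = 0} b"
    by (simp add: quotient_basis_kernel_iff[OF assms(1)])
  moreover have "free_mod.subspace {f. \<phi> f = 0}"
    by (rule subspace_kernel)
  ultimately show ?thesis
    by (auto simp: quot_points_def)
qed

text \<open>
  The preimages under \<open>\<phi>\<close> of the common eigenvectors span the one-dimensional summands.
\<close>

lemma kernel_semisimple: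
  assumes hom: "matrix_module_hom X \<phi>" and "surj \<phi>" and P: "common_eigenbasis P X"
  shows "semisimple_quotient {f. \<phi> f = 0}"
proof -
  interpret module_hom "(*s)" "\<lambda>p a. mat_eval X p *v a" \<phi> by fact
  have "\<forall>h. \<exists>f. \<phi> f = column h P"
    using assms(2) by (metis surjD)
  then obtain b where b: "\<And>h. \<phi> (b h) = column h P"
    by metis
  then have "image_matrix \<phi> b = P"
    by (simp add: image_matrix_def column_def vec_eq_iff)
  then have "quotient_basis {f. \<phi> f = 0} b"
    using P by (simp add: quotient_basis_kernel_iff[OF hom] common_eigenbasis_def)
  moreover have "\<exists>\<mu>. p *s b h - poly_const \<mu> *s b h \<in> {f. \<phi> f = 0}" for h p
  proof -
    have "\<exists>\<mu>. mat_eval X p *v column h P = \<mu> *s column h P"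
      using P by (intro mat_eval_eigenvector) (auto simp: common_eigenbasis_def)
    then show ?thesis
      by (auto simp: diff scale b mat_eval_const mat_scale_vector_mult)
  qed
  ultimately show ?thesis
    unfolding semisimple_quotient_def by blast
qed

lemma tendsto_image_matrix:
  assumes "\<And>f. (\<lambda>n. \<psi> n f) \<longlonglongrightarrow> \<phi> f"
  shows "(\<lambda>n. image_matrix (\<psi> n) b) \<longlonglongrightarrow> image_matrix \<phi> b"
  unfolding image_matrix_def by (intro tendsto_intros assms)

lemma eventually_det_image_matrix:
  assumes "\<And>f. (\<lambda>n. \<psi> n f) \<longlonglongrightarrow> \<phi> f" and "det (image_matrix \<phi> b) \<noteq> 0"
  shows "\<forall>\<^sub>F n in sequentially. det (image_matrix (\<psi> n) b) \<noteq> 0"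
  using tendsto_det[OF tendsto_image_matrix[where \<psi> = \<psi>, OF assms(1)], of b] assms(2)
  by (rule tendsto_imp_eventually_ne)

text \<open>
  The coordinates at \<open>ker (\<psi> n)\<close> solve a linear system whose matrix and right-hand side converge,
  so they converge; sums and products follow.
\<close>

lemma chart_function_tendsto:
  assumes hom: "matrix_module_hom Y \<phi>" and homs: "\<And>n. matrix_module_hom (X n) (\<psi> n)"
    and lim: "\<And>f. (\<lambda>n. \<psi> n f) \<longlonglongrightarrow> \<phi> f"
    and det: "det (image_matrix \<phi> b) \<noteq> 0"
    and "g \<in> chart_functions b"
  shows "(\<lambda>n. g {f. \<psi> n f = 0}) \<longlonglongrightarrow> g {f. \<phi> f = 0}"
  using assms(5)
proof induction
  case (coord f h)
  have "\<forall>\<^sub>F n in sequentially.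
      image_matrix (\<psi> n) b *v quotient_coords b {f. \<psi> n f = 0} f = \<psi> n f"
    using eventually_det_image_matrix[where \<psi> = \<psi>, OF lim det]
    by eventually_elim (rule quotient_coords_kernel[OF homs])
  then have "(\<lambda>n. quotient_coords b {f. \<psi> n f = 0} f) \<longlonglongrightarrow> quotient_coords b {f. \<phi> f = 0} f"
    by (rule tendsto_linear_solution[OF tendsto_image_matrix[where \<psi> = \<psi>, OF lim] lim det
          quotient_coords_kernel[OF hom det]])
  then show ?case
    by (rule tendsto_vec_nth)
qed (auto intro: tendsto_intros)

text \<open>
  On the subbasic open set given by \<open>b\<close> and \<open>g\<close>, both \<open>det (image_matrix \<phi> b)\<close> and the value of
  \<open>g\<close> are nonzero in the limit, hence eventually nonzero. The property passes to finite
  intersections and arbitrary unions.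
\<close>

lemma kernel_limit_eventually_in_open:
  assumes hom: "matrix_module_hom Y \<phi>" and homs: "\<And>n. matrix_module_hom (X n) (\<psi> n)"
    and lim: "\<And>f. (\<lambda>n. \<psi> n f) \<longlonglongrightarrow> \<phi> f"
    and points: "\<And>n. {f. \<psi> n f = 0} \<in> quot_points"
    and "openin quot_zariski U" and "{f. \<phi> f = 0} \<in> U"
  shows "\<forall>\<^sub>F n in sequentially. {f. \<psi> n f = 0} \<in> U"
proof -
  have "generate_topology_on
      {{K \<in> quot_points. quotient_basis K b \<and> g K \<noteq> 0} | b g. g \<in> chart_functions b} U"
    using assms(5) unfolding quot_zariski_def by (rule openin_topology_generated_by)
  then show ?thesis
    using assms(6)
  proof induction
    case Empty
    then show ?case by simp
  next
    case (Int U V)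
    then show ?case by (simp add: eventually_conj)
  next
    case (UN \<U>)
    then obtain V where "V \<in> \<U>" "{f. \<phi> f = 0} \<in> V"
      by blast
    then have "\<forall>\<^sub>F n in sequentially. {f. \<psi> n f = 0} \<in> V"
      using UN.IH by simp
    then show ?case
      by (rule eventually_mono) (use \<open>V \<in> \<U>\<close> in blast)
  next
    case (Basis V)
    then obtain b g where V: "V = {K \<in> quot_points. quotient_basis K b \<and> g K \<noteq> 0}"
      and g: "g \<in> chart_functions b"
      by blast
    then have det: "det (image_matrix \<phi> b) \<noteq> 0" and "g {f. \<phi> f = 0} \<noteq> 0"
      using Basis.prems quotient_basis_kernel_iff[OF hom] by auto
    then have "\<forall>\<^sub>F n in sequentially. g {f. \<psi> n f = 0} \<noteq> 0"
      using chart_function_tendsto[where \<psi> = \<psi>, OF hom homs lim det g]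
      by (intro tendsto_imp_eventually_ne)
    moreover have "\<forall>\<^sub>F n in sequentially. det (image_matrix (\<psi> n) b) \<noteq> 0"
      by (rule eventually_det_image_matrix[where \<psi> = \<psi>, OF lim det])
    ultimately show ?case
      by eventually_elim (simp add: V points quotient_basis_kernel_iff[OF homs])
  qed
qed

lemma surj_of_det_image_matrix:
  assumes "matrix_module_hom X \<phi>" and "det (image_matrix \<phi> b) \<noteq> 0"
  shows "surj \<phi>"
  unfolding surj_def
proof
  fix y
  have "\<exists>!c. image_matrix \<phi> b *v c = y"
    using assms(2) by (simp add: cramer)
  then show "\<exists>f. y = \<phi> f"
    using hom_combination[OF assms(1)] by metis
qed

text \<open>
  The approximating modules are presented by the images under \<open>\<phi>\<close> of the standard
  generators. Finitely many of the approximating maps may fail to be surjective, and these are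
  dropped.
\<close>

lemma kernel_in_principal_component:
  fixes Y :: "nat \<Rightarrow> 'm::finite mat" and \<phi> :: "('m, 'r::finite) free_mod \<Rightarrow> complex^'m"
  assumes lim: "\<And>i. i \<in> {1..<CARD('m)} \<Longrightarrow> (\<lambda>n. X n i) \<longlonglongrightarrow> Y i"
    and eig: "\<And>n. common_eigenbasis (P n) (X n)"
    and hom: "matrix_module_hom Y \<phi>" and "surj \<phi>"
  shows "{f. \<phi> f = 0} \<in> principal_component"
proof -
  define \<psi> where "\<psi> n = presentation (X n) (\<lambda>j. \<phi> (axis j 1))" for n
  have homs: "matrix_module_hom (X n) (\<psi> n)" for n
    unfolding \<psi>_def by (intro presentation_hom common_eigenbasis_commuting[OF eig])
  have conv0: "(\<lambda>n. \<psi> n f) \<longlonglongrightarrow> presentation Y (\<lambda>j. \<phi> (axis j 1)) f" for f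
    unfolding \<psi>_def presentation_def
    by (intro tendsto_sum tendsto_matrix_vector_mult tendsto_mat_eval lim tendsto_const)
  have conv: "(\<lambda>n. \<psi> n f) \<longlonglongrightarrow> \<phi> f" for f
    by (subst hom_eq_presentation[OF hom]) (rule conv0)
  have point: "{f. \<phi> f = 0} \<in> quot_points"
    using hom \<open>surj \<phi>\<close> by (rule kernel_in_quot_points)
  then obtain b where b: "quotient_basis {f. \<phi> f = 0} b"
    by (auto simp: quot_points_def)
  then have "\<forall>\<^sub>F n in sequentially. det (image_matrix (\<psi> n) b) \<noteq> 0"
    unfolding quotient_basis_kernel_iff[OF hom]
    by (rule eventually_det_image_matrix[where \<psi> = \<psi>, OF conv])
  then obtain N where N: "\<And>n. n \<ge> N \<Longrightarrow> det (image_matrix (\<psi> n) b) \<noteq> 0"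
    by (auto simp: eventually_sequentially)
  define \<psi>' where "\<psi>' n = \<psi> (n + N)" for n
  have surj: "surj (\<psi>' n)" for n
    unfolding \<psi>'_def by (rule surj_of_det_image_matrix[OF homs N]) simp
  have homs': "matrix_module_hom (X (n + N)) (\<psi>' n)" for n
    unfolding \<psi>'_def by (rule homs)
  have conv': "(\<lambda>n. \<psi>' n f) \<longlonglongrightarrow> \<phi> f" for f
    unfolding \<psi>'_def by (rule LIMSEQ_ignore_initial_segment[OF conv])
  have points: "{f. \<psi>' n f = 0} \<in> quot_points" for n
    by (rule kernel_in_quot_points[OF homs' surj])
  have semisimple: "semisimple_quotient {f. \<psi>' n f = 0}" for n
    by (rule kernel_semisimple[OF homs' surj eig])
  have "openin quot_zariski
      {K \<in> quot_points. quotient_basis K b \<and> (\<lambda>K. 1 :: complex) K \<noteq> 0}"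
    unfolding quot_zariski_def
    by (rule topology_generated_by_Basis)
      (intro CollectI exI[of _ b] exI[of _ "\<lambda>K. 1"] conjI refl chart_functions.const)
  then have "{f. \<phi> f = 0} \<in> topspace quot_zariski"
    using point b openin_subset by fastforce
  moreover have "\<exists>K. K \<in> {K \<in> quot_points. semisimple_quotient K} \<and> K \<in> U"
    if "{f. \<phi> f = 0} \<in> U" "openin quot_zariski U" for U
  proof -
    have "\<forall>\<^sub>F n in sequentially. {f. \<psi>' n f = 0} \<in> U"
      by (rule kernel_limit_eventually_in_open[where \<psi> = \<psi>', OF hom homs' conv' points that(2,1)])
    then obtain n where "{f. \<psi>' n f = 0} \<in> U"
      by (auto simp: eventually_sequentially)
    then show ?thesis
      using points semisimple by blast
  qed
  ultimately show ?thesis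
    unfolding principal_component_def in_closure_of by blast
qed

text \<open>
  With at least \<open>m\<close> generators a presentation exists: send \<open>m\<close> of them to the standard basis.
\<close>

lemma limit_lies_in_principal_component:
  fixes Y :: "nat \<Rightarrow> 'm::finite mat"
  assumes lim: "\<And>i. i \<in> {1..<CARD('m)} \<Longrightarrow> (\<lambda>n. X n i) \<longlonglongrightarrow> Y i"
    and eig: "\<And>n. common_eigenbasis (P n) (X n)"
    and r: "CARD('r::finite) \<ge> CARD('m)"
  shows "lies_in_principal_component TYPE('r) (\<lambda>p a. mat_eval Y p *v a)"
proof -
  have comm: "commuting Y"
    by (rule commuting_limit[OF lim common_eigenbasis_commuting[OF eig]])
  obtain \<iota> :: "'m \<Rightarrow> 'r" where \<iota>: "inj \<iota>"
    using card_le_inj[of "UNIV :: 'm set" "UNIV :: 'r set"] r by auto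
  \<comment> \<open>The generators outside the range of \<open>\<iota>\<close> are sent to arbitrary vectors.\<close>
  let ?\<phi> = "presentation Y (\<lambda>j. axis (inv \<iota> j) 1)"
  have hom: "matrix_module_hom Y ?\<phi>"
    using comm by (rule presentation_hom)
  have "?\<phi> (axis (\<iota> h) 1) = axis h 1" for h
    by (simp add: presentation_axis[OF comm] \<iota>)
  then have "image_matrix ?\<phi> (\<lambda>h. axis (\<iota> h) 1) = mat 1"
    unfolding image_matrix_def by (simp add: mat_def axis_def vec_eq_iff)
  then have "surj ?\<phi>"
    by (intro surj_of_det_image_matrix[OF hom, of "\<lambda>h. axis (\<iota> h) 1"]) simp
  then show ?thesis
    unfolding lies_in_principal_component_def
    using hom kernel_in_principal_component[OF lim eig] by blast
qed

section \<open>The modules of a 111-sharp tensor\<close>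

theorem lemma5p8:
  fixes T :: "'m::finite tensor" and e :: "nat \<Rightarrow> 'm triple"
  assumes "concise T" and "sharp_111 T" and "minimal_border_rank T"
    and "unital_basis_111 T e"
    and "CARD('r::finite) \<ge> CARD('m)"
  shows "lies_in_principal_component TYPE('r) (module_A e) \<and>
    lies_in_principal_component TYPE('r) (module_B e) \<and>
    lies_in_principal_component TYPE('r) (module_C e)"
proof -
  obtain P Q R d where det: "\<forall>n. det (P n) \<noteq> 0 \<and> det (Q n) \<noteq> 0 \<and> det (R n) \<noteq> 0"
    and lim: "\<forall>x\<in>algebra_111 T. (\<lambda>n. frame_diagonal (P n) (Q n) (R n) (d n x)) \<longlonglongrightarrow> x"
    using algebra_111_limit_of_diagonal_algebras[OF assms(3,4)] by (elim exE conjE) (rule that)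
  have e_lim: "(\<lambda>n. frame_diagonal (P n) (Q n) (R n) (d n (e i))) \<longlonglongrightarrow> e i"
    if "i \<in> {1..<CARD('m)}" for i
  proof -
    have "e i \<in> ctriple.span (e ` {..<CARD('m)})"
      using that by (intro ctriple.span_base) auto
    then show ?thesis
      using lim assms(4) by (simp add: unital_basis_111_def)
  qed
  have eig: "common_eigenbasis S (\<lambda>i. diag_in S (D i))" if "det S \<noteq> 0" for S :: "'m mat" and D
    using diag_in_column[OF that] that by (auto simp: common_eigenbasis_def)
  have "lies_in_principal_component TYPE('r) (\<lambda>p a. mat_eval (\<lambda>i. fst (e i)) p *v a)"
  proof (rule limit_lies_in_principal_component)
    show "(\<lambda>n. diag_in (P n) (d n (e i))) \<longlonglongrightarrow> fst (e i)" if "i \<in> {1..<CARD('m)}" for i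
      using tendsto_fst[OF e_lim[OF that]] by (simp add: frame_diagonal_def)
    show "common_eigenbasis (P n) (\<lambda>i. diag_in (P n) (d n (e i)))" for n
      by (rule eig) (simp add: det)
  qed (rule assms(5))
  moreover have
    "lies_in_principal_component TYPE('r) (\<lambda>p b. mat_eval (\<lambda>i. fst (snd (e i))) p *v b)"
  proof (rule limit_lies_in_principal_component)
    show "(\<lambda>n. diag_in (Q n) (d n (e i))) \<longlonglongrightarrow> fst (snd (e i))" if "i \<in> {1..<CARD('m)}" for i
      using tendsto_fst[OF tendsto_snd[OF e_lim[OF that]]] by (simp add: frame_diagonal_def)
    show "common_eigenbasis (Q n) (\<lambda>i. diag_in (Q n) (d n (e i)))" for n
      by (rule eig) (simp add: det)
  qed (rule assms(5))
  moreover have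
    "lies_in_principal_component TYPE('r) (\<lambda>p c. mat_eval (\<lambda>i. snd (snd (e i))) p *v c)"
  proof (rule limit_lies_in_principal_component)
    show "(\<lambda>n. diag_in (R n) (d n (e i))) \<longlonglongrightarrow> snd (snd (e i))" if "i \<in> {1..<CARD('m)}" for i
      using tendsto_snd[OF tendsto_snd[OF e_lim[OF that]]] by (simp add: frame_diagonal_def)
    show "common_eigenbasis (R n) (\<lambda>i. diag_in (R n) (d n (e i)))" for n
      by (rule eig) (simp add: det)
  qed (rule assms(5))
  ultimately show ?thesis
    by (simp add: module_A_def[abs_def] module_B_def[abs_def] module_C_def[abs_def]
        poly_to_111_def)
qed

end
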